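(* Let $f:\operatorname{dom} f\subseteq\mathbb{R}^n\to\mathbb{R}$, let $x^0\in\operatorname{dom} f$ be the point of interest, let $S=\begin{bmatrix}s^1&s^2&\cdots&s^m\end{bmatrix}\in\mathbb{R}^{n\times m}$ and let $T_j=-s^j\in\mathbb{R}^n$ for all $j\in\{1,\dots,m\}$. Let $z\in\mathbb{R}^n$ be the vector containing the $n$ diagonal entries of the generalized centered simplex Hessian $\nabla_c^2 f(x^0;S,T_{1:m})$, i.e. $z_i=\left[\nabla_c^2 f(x^0;S,T_{1:m})\right]_{i,i}$ for all $i\in\{1,\dots,n\}$. If $S$ is a partial diagonal matrix with full column rank, then $z=d\nabla^2 f(x^0;S)$, where $d\nabla^2 f(x^0;S)$ is the centered simplex Hessian diagonal of $f$ at $x^0$ over $S$.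
   Context: $A^\dagger$ is the Moore-Penrose pseudoinverse of a real matrix $A$ (vectors in $\mathbb{R}^n$ are $n\times1$ matrices). $\oplus$ is the Minkowski sum; a matrix is identified with the set of its columns, so $x^0\oplus S=\{x^0+s^1,\dots,x^0+s^m\}$. Generalized simplex gradient: for a matrix $T=\begin{bmatrix}t^1&\cdots&t^k\end{bmatrix}\in\mathbb{R}^{n\times k}$ and a point $x$ with $x\in\operatorname{dom} f$ and $x\oplus T\subset\operatorname{dom} f$, $\nabla_s f(x;T)=(T^\top)^\dagger\,\delta_s f(x;T)\in\mathbb{R}^n$, where $\delta_s f(x;T)=\big(f(x+t^1)-f(x),\dots,f(x+t^k)-f(x)\big)^\top\in\mathbb{R}^k$. Generalized simplex Hessian: for $S=\begin{bmatrix}s^1&\cdots&s^m\end{bmatrix}\in\mathbb{R}^{n\times m}$ and $T_{1:m}=\{T_1,\dots,T_m\}$ with $T_j\in\mathbb{R}^{n\times k_j}$, such that $x^0\oplus T_j$, $x^0\oplus S$, $x^0+s^j\oplus T_j$ are contained in $\operatorname{dom} f$ for all $j$, $\nabla_s^2 f(x^0;S,T_{1:m})=(S^\top)^\dagger\,\delta_s^2 f(x^0;S,T_{1:m})\in\mathbb{R}^{n\times n}$, where $\delta_s^2 f(x^0;S,T_{1:m})\in\mathbb{R}^{m\times n}$ is the matrix whose $j$-th row is $\big(\nabla_s f(x^0+s^j;T_j)-\nabla_s f(x^0;T_j)\big)^\top$. Generalized centered simplex Hessian: $\nabla_c^2 f(x^0;S,T_{1:m})=\tfrac12\big(\nabla_s^2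 f(x^0;S,T_{1:m})+\nabla_s^2 f(x^0;-S,-T_{1:m})\big)$, where $-T_{1:m}=\{-T_1,\dots,-T_m\}$; it is defined when $x^0\oplus S\oplus T_j$, $x^0\oplus(-S)\oplus(-T_j)$, $x^0\oplus(\pm S)$ and $x^0\oplus(\pm T_j)$ are contained in $\operatorname{dom} f$ for all $j$. Centered simplex Hessian diagonal: let $\odot$ be the componentwise (Hadamard) product and $W=\begin{bmatrix}s^1\odot s^1&\cdots&s^m\odot s^m\end{bmatrix}\in\mathbb{R}^{n\times m}$. Assuming $x^0\oplus(\pm S)\subset\operatorname{dom} f$, $d\nabla^2 f(x^0;S)=(W^\top)^\dagger\,\varepsilon f(x^0;S)\in\mathbb{R}^n$, where $\varepsilon f(x^0;S)\in\mathbb{R}^m$ has $j$-th entry $f(x^0+s^j)+f(x^0-s^j)-2f(x^0)$. Partial diagonal matrix: $M\in\mathbb{R}^{n\times m}$, $m\le n$, is a partial diagonal matrix if there exists a diagonal matrix $D\in\mathbb{R}^{n\times n}$ such that for each column $Me^j$, $j\in\{1,\dots,m\}$, there is a distinct index $i\in\{1,\dots,n\}$ (different columns of $M$ get different indices) with $Me^j=De^i$; i.e. the columns of $M$ are a subset, in any order, of the columns of a single diagonal matrix. Standing assumptions: all points required by these definitions lie in $\operatorname{dom} f$; $S$ and all $T_j$ are non-empty with non-null rank. *)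

theory Defs
  imports "Jordan_Normal_Form.DL_Rank" "HOL-Library.Set_Algebras"
begin

text \<open>
  Vectors and matrices are those of \<open>Jordan_Normal_Form\<close>, so that the families of direction
  matrices may have members with different numbers of columns. Indices start at 0.
  A partial function with domain \<open>D\<close> is given by a total function on \<open>real vec\<close> together with \<open>D\<close>;
  the predicates ending in \<open>_dom\<close> say which points have to lie in \<open>D\<close>.
\<close>

subsection \<open>Moore-Penrose pseudoinverse\<close>

definition is_pinv :: "real mat \<Rightarrow> real mat \<Rightarrow> bool" where
  "is_pinv A X \<longleftrightarrow>
     X \<in> carrier_mat (dim_col A) (dim_row A) \<and>
     A * X * A = A \<and> X * A * X = X \<and>
     transpose_mat (A * X) = A * X \<and> transpose_mat (X * A) = X * A"

definition pinv :: "real mat \<Rightarrow> real mat" where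
  "pinv A = (THE X. is_pinv A X)"

lemma is_pinv_unique:
  assumes "is_pinv A X" "is_pinv A Y"
  shows "X = Y"
proof -
  define m n where "m = dim_row A" and "n = dim_col A"
  have A[simp]: "A \<in> carrier_mat m n" by (auto simp: m_def n_def)
  have X[simp]: "X \<in> carrier_mat n m" and Y[simp]: "Y \<in> carrier_mat n m"
    using assms by (auto simp: is_pinv_def m_def n_def)
  have x: "A * X * A = A" "X * A * X = X" "transpose_mat (A * X) = A * X"
      "transpose_mat (X * A) = X * A"
    and y: "A * Y * A = A" "Y * A * Y = Y" "transpose_mat (A * Y) = A * Y"
      "transpose_mat (Y * A) = Y * A"
    using assms by (auto simp: is_pinv_def)
  have AX[simp]: "A * X \<in> carrier_mat m m" and AY[simp]: "A * Y \<in> carrier_mat m m"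
    and XA[simp]: "X * A \<in> carrier_mat n n" and YA[simp]: "Y * A \<in> carrier_mat n n"
    by (auto intro: mult_carrier_mat[OF A X] mult_carrier_mat[OF A Y]
        mult_carrier_mat[OF X A] mult_carrier_mat[OF Y A])
  have "A * X = (A * Y) * (A * X)"
    using assoc_mult_mat[OF AY A X] y(1) by simp
  then have "transpose_mat (A * X) = transpose_mat ((A * Y) * (A * X))" by simp
  also have "\<dots> = (A * X) * (A * Y)"
    using transpose_mult[OF AY AX] x(3) y(3) by simp
  also have "\<dots> = A * Y"
    using assoc_mult_mat[OF AX A Y] x(1) by simp
  finally have 1: "A * X = A * Y" using x(3) by simp
  have "X * A = (X * A) * (Y * A)"
    using assoc_mult_mat[OF X A YA] assoc_mult_mat[OF A Y A] y(1) by simp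
  then have "transpose_mat (X * A) = transpose_mat ((X * A) * (Y * A))" by simp
  also have "\<dots> = (Y * A) * (X * A)"
    using transpose_mult[OF XA YA] x(4) y(4) by simp
  also have "\<dots> = Y * A"
    using assoc_mult_mat[OF Y A XA] assoc_mult_mat[OF A X A] x(1) by simp
  finally have 2: "X * A = Y * A" using x(4) by simp
  have "X = Y * A * X" using x(2) 2 by simp
  also have "\<dots> = Y" using assoc_mult_mat[OF Y A X] assoc_mult_mat[OF Y A Y] 1 y(2) by simp
  finally show ?thesis .
qed

lemma pinv_eqI: "is_pinv A X \<Longrightarrow> pinv A = X"
  unfolding pinv_def using is_pinv_unique by blast

subsection \<open>Generalized simplex gradient and simplex Hessians\<close>

definition delta_s :: "(real vec \<Rightarrow> real) \<Rightarrow> real vec \<Rightarrow> real mat \<Rightarrow> real vec" where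
  "delta_s f x T = vec (dim_col T) (\<lambda>i. f (x + col T i) - f x)"

definition simplex_gradient :: "(real vec \<Rightarrow> real) \<Rightarrow> real vec \<Rightarrow> real mat \<Rightarrow> real vec" where
  "simplex_gradient f x T = pinv (transpose_mat T) *\<^sub>v delta_s f x T"

text \<open>A family \<open>T\<^sub>1, \<dots>, T\<^sub>m\<close> is a function on \<open>nat\<close>, used only at arguments below \<open>dim_col S\<close>.\<close>

definition delta2_s ::
  "(real vec \<Rightarrow> real) \<Rightarrow> real vec \<Rightarrow> real mat \<Rightarrow> (nat \<Rightarrow> real mat) \<Rightarrow> real mat" where
  "delta2_s f x S T =
     mat_of_rows (dim_row S)
       (map (\<lambda>j. simplex_gradient f (x + col S j) (T j) - simplex_gradient f x (T j))
            [0..<dim_col S])"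

definition simplex_hessian ::
  "(real vec \<Rightarrow> real) \<Rightarrow> real vec \<Rightarrow> real mat \<Rightarrow> (nat \<Rightarrow> real mat) \<Rightarrow> real mat" where
  "simplex_hessian f x S T = pinv (transpose_mat S) * delta2_s f x S T"

definition centered_simplex_hessian ::
  "(real vec \<Rightarrow> real) \<Rightarrow> real vec \<Rightarrow> real mat \<Rightarrow> (nat \<Rightarrow> real mat) \<Rightarrow> real mat" where
  "centered_simplex_hessian f x S T =
     (1/2) \<cdot>\<^sub>m (simplex_hessian f x S T + simplex_hessian f x (- S) (\<lambda>j. - T j))"

definition centered_simplex_hessian_dom ::
  "real vec set \<Rightarrow> real vec \<Rightarrow> real mat \<Rightarrow> (nat \<Rightarrow> real mat) \<Rightarrow> bool" where
  "centered_simplex_hessian_dom D x S T \<longleftrightarrow>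
     x \<in> D \<and>
     x +o set (cols S) \<subseteq> D \<and> x +o set (cols (- S)) \<subseteq> D \<and>
     (\<forall>j < dim_col S.
        x +o set (cols (T j)) \<subseteq> D \<and> x +o set (cols (- T j)) \<subseteq> D \<and>
        x +o (set (cols S) + set (cols (T j))) \<subseteq> D \<and>
        x +o (set (cols (- S)) + set (cols (- T j))) \<subseteq> D)"

subsection \<open>Centered simplex Hessian diagonal\<close>

definition hadamard_square :: "real mat \<Rightarrow> real mat" where
  "hadamard_square S = mat (dim_row S) (dim_col S) (\<lambda>(i, j). S $$ (i, j) * S $$ (i, j))"

definition epsilon_c :: "(real vec \<Rightarrow> real) \<Rightarrow> real vec \<Rightarrow> real mat \<Rightarrow> real vec" where
  "epsilon_c f x S = vec (dim_col S) (\<lambda>j. f (x + col S j) + f (x - col S j) - 2 * f x)"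

definition centered_simplex_hessian_diagonal ::
  "(real vec \<Rightarrow> real) \<Rightarrow> real vec \<Rightarrow> real mat \<Rightarrow> real vec" where
  "centered_simplex_hessian_diagonal f x S =
     pinv (transpose_mat (hadamard_square S)) *\<^sub>v epsilon_c f x S"

definition centered_simplex_hessian_diagonal_dom ::
  "real vec set \<Rightarrow> real vec \<Rightarrow> real mat \<Rightarrow> bool" where
  "centered_simplex_hessian_diagonal_dom D x S \<longleftrightarrow>
     x \<in> D \<and> x +o set (cols S) \<subseteq> D \<and> x +o set (cols (- S)) \<subseteq> D"

subsection \<open>Partial diagonal matrices\<close>

definition partial_diagonal_mat :: "real mat \<Rightarrow> bool" where
  "partial_diagonal_mat M \<longleftrightarrow>
     dim_col M \<le> dim_row M \<and>
     (\<exists>D \<in> carrier_mat (dim_row M) (dim_row M). diagonal_mat D \<and>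
        (\<exists>\<sigma>. inj_on \<sigma> {..<dim_col M} \<and> \<sigma> ` {..<dim_col M} \<subseteq> {..<dim_row M} \<and>
             (\<forall>j < dim_col M. col M j = col D (\<sigma> j))))"

end

theory Submission
  imports Defs
begin

text \<open>
  The columns of a partial diagonal matrix \<open>S\<close> are \<open>a\<^sub>j e\<^bsub>\<sigma>(j)\<^esub>\<close> with \<open>\<sigma>\<close> injective, so the pseudoinverse
  of its transpose is obtained by inverting the \<open>a\<^sub>j\<close>. For \<open>T\<^sub>j = -s\<^sup>j\<close> the \<open>j\<close>-th row of
  \<open>\<delta>\<^sub>s\<^sup>2 f\<close> is the second difference of \<open>f\<close> along \<open>s\<^sup>j\<close>, divided by \<open>a\<^sub>j\<close>, in position \<open>\<sigma>(j)\<close>.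
  Multiplying by the pseudoinverse divides by \<open>a\<^sub>j\<close> once more, which is the effect of the pseudoinverse
  belonging to the squared entries. Replacing \<open>S\<close> by \<open>-S\<close> changes neither the second differences nor
  the squares, so both halves of the centered Hessian have the same diagonal.
\<close>

text \<open>This one form covers \<open>S\<close>, \<open>- S\<close>, the Hadamard square of
  \<open>S\<close> and each single-column \<open>T j\<close>, so a single pseudoinverse formula
  serves them all.\<close>

definition scaled_unit_cols :: "nat \<Rightarrow> nat \<Rightarrow> (nat \<Rightarrow> nat) \<Rightarrow> (nat \<Rightarrow> real) \<Rightarrow> real mat" where
  "scaled_unit_cols n m \<sigma> a = mat n m (\<lambda>(i, j). if i = \<sigma> j then a j else 0)"

lemma scaled_unit_cols_dim [simp]:
  "dim_row (scaled_unit_cols n m \<sigma> a) = n" "dim_col (scaled_unit_cols n m \<sigma> a) = m"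
  by (simp_all add: scaled_unit_cols_def)

lemma scaled_unit_cols_carrier [simp]: "scaled_unit_cols n m \<sigma> a \<in> carrier_mat n m"
  by (simp add: scaled_unit_cols_def)

lemma scaled_unit_cols_index [simp]:
  "i < n \<Longrightarrow> j < m \<Longrightarrow> scaled_unit_cols n m \<sigma> a $$ (i, j) = (if i = \<sigma> j then a j else 0)"
  by (simp add: scaled_unit_cols_def)

lemma sum_delta_mult:
  fixes c :: "'a::semiring_0"
  assumes "finite A" "k \<in> A"
  shows "(\<Sum>i\<in>A. (if i = k then c else 0) * g i) = c * g k"
proof -
  have "(\<Sum>i\<in>A. (if i = k then c else 0) * g i) = (\<Sum>i\<in>A. if i = k then c * g i else 0)"
    by (rule sum.cong) auto
  then show ?thesis using assms by simp
qed

text \<open>For \<open>a j = 0\<close> the junk value \<open>inverse 0 = 0\<close> is the correct entry of the pseudoinverse.\<close>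

lemma pinv_transpose_scaled_unit_cols:
  assumes inj: "inj_on \<sigma> {..<m}" and lt: "\<And>j. j < m \<Longrightarrow> \<sigma> j < n"
  shows "pinv (transpose_mat (scaled_unit_cols n m \<sigma> a)) =
    scaled_unit_cols n m \<sigma> (\<lambda>j. inverse (a j))"
proof (rule pinv_eqI)
  define A where "A = transpose_mat (scaled_unit_cols n m \<sigma> a)"
  define X where "X = scaled_unit_cols n m \<sigma> (\<lambda>j. inverse (a j))"
  have A: "A \<in> carrier_mat m n" and X: "X \<in> carrier_mat n m"
    by (simp_all add: A_def X_def)
  have A_index: "A $$ (j, i) = (if i = \<sigma> j then a j else 0)" if "j < m" "i < n" for i j
    using that by (simp add: A_def)
  have X_index: "X $$ (i, j) = (if i = \<sigma> j then inverse (a j) else 0)" if "i < n" "j < m" for i j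
    using that by (simp add: X_def)
  have AX: "A * X = mat m m (\<lambda>(j, k). if k = j then a j * inverse (a j) else 0)"
  proof (rule eq_matI)
    fix j k assume "j < dim_row (mat m m (\<lambda>(j, k). if k = j then a j * inverse (a j) else 0))"
      and "k < dim_col (mat m m (\<lambda>(j, k). if k = j then a j * inverse (a j) else 0))"
    then have jk: "j < m" "k < m" by simp_all
    have "(A * X) $$ (j, k) = (\<Sum>i = 0..<n. (if i = \<sigma> j then a j else 0) * X $$ (i, k))"
      using A X jk by (auto simp: scalar_prod_def A_index)
    also have "\<dots> = a j * X $$ (\<sigma> j, k)"
      using lt jk by (intro sum_delta_mult) auto
    \<comment> \<open>For \<open>k \<noteq> j\<close>, injectivity gives
      \<open>\<sigma> j \<noteq> \<sigma> k\<close>, and the entry of \<open>X\<close>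
      vanishes.\<close>
    also have "\<dots> = (if k = j then a j * inverse (a j) else 0)"
      using lt jk inj_onD[OF inj, of j k] by (auto simp: X_index)
    finally show "(A * X) $$ (j, k) = mat m m (\<lambda>(j, k). if k = j then a j * inverse (a j) else 0) $$ (j, k)"
      using jk by simp
  qed (use A X in auto)
  have AXA: "A * X * A = A"
  proof (rule eq_matI)
    fix j i assume "j < dim_row A" "i < dim_col A"
    then have ji: "j < m" "i < n" using A by auto
    have "(A * X * A) $$ (j, i) =
        (\<Sum>k = 0..<m. (if k = j then a j * inverse (a j) else 0) * A $$ (k, i))"
      using A ji by (auto simp: AX scalar_prod_def)
    also have "\<dots> = a j * inverse (a j) * A $$ (j, i)"
      using ji by (intro sum_delta_mult) auto
    \<comment> \<open>The factor is 1 unless \<open>a j = 0\<close>, and then row \<open>j\<close>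
      of \<open>A\<close> is zero anyway.\<close>
    also have "\<dots> = A $$ (j, i)" using ji by (cases "a j = 0") (auto simp: A_index)
    finally show "(A * X * A) $$ (j, i) = A $$ (j, i)" .
  qed (use A X in auto)
  have XAX: "X * (A * X) = X"
  proof (rule eq_matI)
    fix i j assume "i < dim_row X" "j < dim_col X"
    then have ij: "i < n" "j < m" using X by auto
    have "(X * (A * X)) $$ (i, j) =
        (\<Sum>k = 0..<m. (if k = j then a j * inverse (a j) else 0) * X $$ (i, k))"
      using X ij by (auto simp: AX scalar_prod_def mult.commute intro!: sum.cong)
    also have "\<dots> = a j * inverse (a j) * X $$ (i, j)"
      using ij by (intro sum_delta_mult) auto
    also have "\<dots> = X $$ (i, j)" using ij by (cases "a j = 0") (auto simp: X_index)
    finally show "(X * (A * X)) $$ (i, j) = X $$ (i, j)" .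
  qed (use A X in auto)
  \<comment> \<open>Swapping the two outer indices leaves each summand unchanged: it is nonzero only
    if both equal \<open>\<sigma> k\<close>.\<close>
  have XA: "transpose_mat (X * A) = X * A"
    using A X by (intro eq_matI) (auto simp: scalar_prod_def A_index X_index intro!: sum.cong)
  have AX_sym: "transpose_mat (A * X) = A * X"
    unfolding AX by (intro eq_matI) auto
  have "X \<in> carrier_mat (dim_col A) (dim_row A)" using A X by auto
  moreover have "X * A * X = X" unfolding assoc_mult_mat[OF X A X] by (rule XAX)
  ultimately show "is_pinv A X"
    unfolding is_pinv_def using AXA AX_sym XA by (intro conjI)
qed

text \<open>Column \<open>\<sigma> j\<close> of a diagonal matrix vanishes off its diagonal entry;
  that entry, possibly zero, becomes \<open>a j\<close>.\<close>

lemma partial_diagonal_matE: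
  assumes "partial_diagonal_mat S" "S \<in> carrier_mat n m"
  obtains \<sigma> a where "inj_on \<sigma> {..<m}" "\<forall>j<m. \<sigma> j < n" "S = scaled_unit_cols n m \<sigma> a"
proof -
  from assms obtain D \<sigma> where D: "D \<in> carrier_mat n n" "diagonal_mat D"
    and \<sigma>: "inj_on \<sigma> {..<m}" "\<sigma> ` {..<m} \<subseteq> {..<n}"
    and col: "\<And>j. j < m \<Longrightarrow> col S j = col D (\<sigma> j)"
    unfolding partial_diagonal_mat_def by auto
  have lt: "\<sigma> j < n" if "j < m" for j using \<sigma>(2) that by auto
  have "S $$ (i, j) = (if i = \<sigma> j then D $$ (\<sigma> j, \<sigma> j) else 0)" if "i < n" "j < m" for i j
  proof -
    have "S $$ (i, j) = col S j $ i" using assms(2) that by simp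
    also have "\<dots> = D $$ (i, \<sigma> j)" using D(1) that lt by (simp add: col)
    finally show ?thesis using D that lt by (auto simp: diagonal_mat_def)
  qed
  then have "S = scaled_unit_cols n m \<sigma> (\<lambda>j. D $$ (\<sigma> j, \<sigma> j))"
    using assms(2) by (intro eq_matI) auto
  then show thesis using that \<sigma>(1) lt by blast
qed

lemma col_scaled_unit_cols:
  "j < m \<Longrightarrow> col (scaled_unit_cols n m \<sigma> a) j = vec n (\<lambda>i. if i = \<sigma> j then a j else 0)"
  by (intro eq_vecI) auto

lemma uminus_scaled_unit_cols:
  "- scaled_unit_cols n m \<sigma> a = scaled_unit_cols n m \<sigma> (\<lambda>j. - a j)"
  by (intro eq_matI) auto

lemma uminus_mat_of_cols_singleton:
  "v \<in> carrier_vec n \<Longrightarrow> - mat_of_cols n [v] = mat_of_cols n [- v]"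
  by (intro eq_matI) (auto simp: mat_of_cols_index)

lemma hadamard_square_scaled_unit_cols:
  "hadamard_square (scaled_unit_cols n m \<sigma> a) = scaled_unit_cols n m \<sigma> (\<lambda>j. a j * a j)"
  by (intro eq_matI) (auto simp: hadamard_square_def)

text \<open>The one-column case of the general formula: a constant index map is injective on a
  singleton.\<close>

lemma pinv_transpose_scaled_unit_col:
  assumes "k < n" and s: "s = vec n (\<lambda>i. if i = k then c else 0)"
  shows "pinv (transpose_mat (mat_of_cols n [s])) = scaled_unit_cols n 1 (\<lambda>_. k) (\<lambda>_. inverse c)"
proof -
  have "mat_of_cols n [s] = scaled_unit_cols n 1 (\<lambda>_. k) (\<lambda>_. c)"
    using s by (intro eq_matI) (auto simp: mat_of_cols_index)
  moreover have "inj_on (\<lambda>_. k) {..<1::nat}" by (auto intro: inj_onI)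
  ultimately show ?thesis
    using assms(1) pinv_transpose_scaled_unit_cols[of "\<lambda>_. k" 1 n "\<lambda>_. c"] by simp
qed

lemma simplex_gradient_scaled_unit_col:
  assumes "k < n" "i < n" and s: "s = vec n (\<lambda>i. if i = k then c else 0)"
  shows "simplex_gradient f x (mat_of_cols n [s]) $ i =
    (if i = k then inverse c * (f (x + s) - f x) else 0)"
proof -
  have "col (mat_of_cols n [s]) 0 = s"
    using s by (intro eq_vecI) (auto simp: mat_of_cols_index)
  then show ?thesis
    using assms(2) unfolding simplex_gradient_def pinv_transpose_scaled_unit_col[OF assms(1) s]
    by (simp add: delta_s_def scalar_prod_def)
qed

lemma simplex_gradient_dim:
  assumes "k < n" and s: "s = vec n (\<lambda>i. if i = k then c else 0)"
  shows "dim_vec (simplex_gradient f x (mat_of_cols n [s])) = n"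
  unfolding simplex_gradient_def pinv_transpose_scaled_unit_col[OF assms] by simp

text \<open>Supplies the index bounds needed to read off an entry of the sum of the two simplex
  Hessians.\<close>

lemma simplex_hessian_carrier:
  assumes "inj_on \<sigma> {..<m}" "\<And>j. j < m \<Longrightarrow> \<sigma> j < n"
  shows "simplex_hessian f x (scaled_unit_cols n m \<sigma> a) T \<in> carrier_mat n n"
  using assms by (auto simp: simplex_hessian_def delta2_s_def pinv_transpose_scaled_unit_cols)

text \<open>Injectivity leaves at most one nonzero term. Keeping the sum allows a termwise
  comparison with the Hessian, also for \<open>i\<close> outside the range of
  \<open>\<sigma>\<close>.\<close>

lemma centered_simplex_hessian_diagonal_index:
  fixes a :: "nat \<Rightarrow> real"
  assumes "inj_on \<sigma> {..<m}" "\<And>j. j < m \<Longrightarrow> \<sigma> j < n" "i < n"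
  defines "S \<equiv> scaled_unit_cols n m \<sigma> a"
  shows "centered_simplex_hessian_diagonal f x S $ i =
    (\<Sum>j = 0..<m. if i = \<sigma> j then inverse (a j * a j) * (f (x + col S j) + f (x - col S j) - 2 * f x) else 0)"
  using assms by (auto simp: centered_simplex_hessian_diagonal_def hadamard_square_scaled_unit_cols
      pinv_transpose_scaled_unit_cols scalar_prod_def epsilon_c_def intro!: sum.cong)

text \<open>The uncentered Hessian already has the desired diagonal: moving back by
  \<open>- col S j\<close> makes its difference of gradients a second difference centered at
  \<open>x\<close>. As \<open>a\<close> is arbitrary, this applies to \<open>- S\<close> as
  well.\<close>

lemma simplex_hessian_diag_index:
  fixes a :: "nat \<Rightarrow> real"
  assumes \<sigma>: "inj_on \<sigma> {..<m}" "\<And>j. j < m \<Longrightarrow> \<sigma> j < n" and i: "i < n"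
    and x: "x \<in> carrier_vec n"
  defines "S \<equiv> scaled_unit_cols n m \<sigma> a"
  assumes T: "\<And>j. j < m \<Longrightarrow> T j = mat_of_cols n [- col S j]"
  shows "simplex_hessian f x S T $$ (i, i) = centered_simplex_hessian_diagonal f x S $ i"
proof -
  define \<epsilon> where "\<epsilon> j = f (x + col S j) + f (x - col S j) - 2 * f x" for j
  have S: "S \<in> carrier_mat n m" by (simp add: S_def)
  have row: "delta2_s f x S T $$ (j, i) = (if i = \<sigma> j then inverse (a j) * \<epsilon> j else 0)"
    if j: "j < m" for j
  proof -
    have s: "- col S j = vec n (\<lambda>i. if i = \<sigma> j then - a j else 0)"
      using j by (intro eq_vecI) (auto simp: S_def col_scaled_unit_cols)
    have c: "col S j \<in> carrier_vec n" using S j by auto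
    have steps: "x + col S j + - col S j = x" "x + - col S j = x - col S j"
      using x c by (auto intro!: eq_vecI)
    have "delta2_s f x S T $$ (j, i) =
      simplex_gradient f (x + col S j) (T j) $ i - simplex_gradient f x (T j) $ i"
      using S j i simplex_gradient_dim[OF \<sigma>(2)[OF j] s]
      by (simp add: delta2_s_def mat_of_rows_index T)
    \<comment> \<open>The difference of the two increments is \<open>- \<epsilon> j\<close>, and the
      direction has coefficient \<open>- a j\<close>, so the signs cancel.\<close>
    also have "\<dots> = (if i = \<sigma> j then inverse (a j) * \<epsilon> j else 0)"
      unfolding T[OF j] simplex_gradient_scaled_unit_col[OF \<sigma>(2)[OF j] i s] steps \<epsilon>_def
      by (simp add: algebra_simps)
    finally show ?thesis .
  qed
  have "simplex_hessian f x S T $$ (i, i) =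
    (\<Sum>j = 0..<m. (if i = \<sigma> j then inverse (a j) else 0) * delta2_s f x S T $$ (j, i))"
    using i \<sigma> unfolding simplex_hessian_def S_def
    by (auto simp: pinv_transpose_scaled_unit_cols scalar_prod_def delta2_s_def intro!: sum.cong)
  \<comment> \<open>The two factors \<open>inverse (a j)\<close> come from the pseudoinverses for
    \<open>S\<close> and for \<open>T j\<close>; if \<open>a j = 0\<close>, both sides are
    zero.\<close>
  also have "\<dots> = (\<Sum>j = 0..<m. if i = \<sigma> j then inverse (a j * a j) * \<epsilon> j else 0)"
    by (intro sum.cong) (auto simp: row)
  also have "\<dots> = centered_simplex_hessian_diagonal f x S $ i"
    unfolding \<epsilon>_def S_def using centered_simplex_hessian_diagonal_index[OF \<sigma> i] by simp
  finally show ?thesis .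
qed

lemma centered_simplex_hessian_diagonal_uminus:
  assumes S: "S \<in> carrier_mat n m" and x: "x \<in> carrier_vec n"
  shows "centered_simplex_hessian_diagonal f x (- S) = centered_simplex_hessian_diagonal f x S"
proof -
  have "hadamard_square (- S) = hadamard_square S"
    using S by (intro eq_matI) (auto simp: hadamard_square_def)
  moreover have "epsilon_c f x (- S) = epsilon_c f x S"
  proof (rule eq_vecI)
    fix j assume "j < dim_vec (epsilon_c f x S)"
    then have j: "j < m" using S by (simp add: epsilon_c_def)
    then have "x + col (- S) j = x - col S j" "x - col (- S) j = x + col S j"
      using S x by (auto intro!: eq_vecI)
    then show "epsilon_c f x (- S) $ j = epsilon_c f x S $ j"
      using S j by (simp add: epsilon_c_def)
  qed (simp add: epsilon_c_def)
  ultimately show ?thesis by (simp add: centered_simplex_hessian_diagonal_def)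
qed

theorem theorem12:
  fixes f :: "real vec \<Rightarrow> real" and domf :: "real vec set"
    and x0 z :: "real vec" and S :: "real mat" and T :: "nat \<Rightarrow> real mat" and n m :: nat
  assumes "domf \<subseteq> carrier_vec n"
    and "x0 \<in> domf"
    and "S \<in> carrier_mat n m"
    and "0 < m"
    and "\<And>j. j < m \<Longrightarrow> T j = mat_of_cols n [- col S j]"
    and "centered_simplex_hessian_dom domf x0 S T"
    and "centered_simplex_hessian_diagonal_dom domf x0 S"
    and "z \<in> carrier_vec n"
    and "\<And>i. i < n \<Longrightarrow> z $ i = centered_simplex_hessian f x0 S T $$ (i, i)"
    and "partial_diagonal_mat S"
    and "vec_space.rank n S = m"
  shows "z = centered_simplex_hessian_diagonal f x0 S"
proof -
  have x0: "x0 \<in> carrier_vec n" using assms(1,2) by auto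
  obtain \<sigma> a where inj: "inj_on \<sigma> {..<m}" and lt: "\<forall>j<m. \<sigma> j < n"
    and S: "S = scaled_unit_cols n m \<sigma> a"
    by (rule partial_diagonal_matE[OF assms(10,3)])
  have \<sigma>: "inj_on \<sigma> {..<m}" "\<And>j. j < m \<Longrightarrow> \<sigma> j < n"
    using inj lt by auto
  \<comment> \<open>This puts the family \<open>- T j\<close> in the same relation to
    \<open>- S\<close> as \<open>T j\<close> has to \<open>S\<close>, so the diagonal lemma also
    handles the second half of the centered Hessian.\<close>
  have uT: "- T j = mat_of_cols n [- col (- S) j]" if "j < m" for j
  proof -
    have "- col S j \<in> carrier_vec n" using that assms(3) by auto
    moreover have "- col S j = col (- S) j" using that assms(3) by simp
    ultimately show ?thesis
      unfolding assms(5)[OF that] by (metis uminus_mat_of_cols_singleton)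
  qed
  have "z $ i = centered_simplex_hessian_diagonal f x0 S $ i" if i: "i < n" for i
  proof -
    have plus: "simplex_hessian f x0 S T $$ (i, i) = centered_simplex_hessian_diagonal f x0 S $ i"
      using simplex_hessian_diag_index[OF \<sigma> i x0] assms(5) unfolding S by simp
    have "simplex_hessian f x0 (- S) (\<lambda>j. - T j) $$ (i, i) =
        centered_simplex_hessian_diagonal f x0 (- S) $ i"
      using simplex_hessian_diag_index[OF \<sigma> i x0] uT unfolding S uminus_scaled_unit_cols by simp
    then have minus: "simplex_hessian f x0 (- S) (\<lambda>j. - T j) $$ (i, i) =
        centered_simplex_hessian_diagonal f x0 S $ i"
      using centered_simplex_hessian_diagonal_uminus[OF assms(3) x0] by simp
    have "simplex_hessian f x0 S T \<in> carrier_mat n n"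
      "simplex_hessian f x0 (- S) (\<lambda>j. - T j) \<in> carrier_mat n n"
      unfolding S uminus_scaled_unit_cols using simplex_hessian_carrier[OF \<sigma>] by auto
    then have "centered_simplex_hessian f x0 S T $$ (i, i) =
        centered_simplex_hessian_diagonal f x0 S $ i"
      using i plus minus by (auto simp: centered_simplex_hessian_def)
    then show ?thesis using assms(9) i by simp
  qed
  moreover have "dim_vec (centered_simplex_hessian_diagonal f x0 S) = n"
    using \<sigma> by (simp add: S centered_simplex_hessian_diagonal_def hadamard_square_scaled_unit_cols
        pinv_transpose_scaled_unit_cols)
  ultimately show ?thesis using assms(8) by (intro eq_vecI) auto
qed

end
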